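(* Let $(X,d)$ be a complete semimetric space with a continuous triangle function $\Phi\colon\mathbb{R}^+\times\mathbb{R}^+\to\mathbb{R}^+$ that satisfies the following three conditions. (1) $\Phi(ku,kv)=k\,\Phi(u,v)$ for all $k,u,v\in\mathbb{R}^+$. (2) For every $0\le a<1$ there exists $C(a)>0$ such that for every positive integer $p$ $$\Phi(1,\Phi(a,\Phi(a^2,\ldots,\Phi(a^{p-1},a^{p}))))\le C(a).$$ (3) $\Phi(0,v)<1$ for all $0\le v<1$. Let $T\colon X\to X$ be a mapping for which there exists $\beta$ with $0\le\beta<1$ such that $$d(Tx,Ty)\le \beta\max\{d(x,Tx),d(y,Ty)\}\quad\text{for all } x,y\in X.$$ Then $T$ has a unique fixed point.
   Context: $\mathbb{R}^+=[0,\infty)$. A semimetric space $(X,d)$ is a nonempty set $X$ with a function $d\colon X\times X\to\mathbb{R}^+$ such that for all $x,y\in X$: $d(x,y)=0$ if and only if $x=y$, and $d(x,y)=d(y,x)$. A function $\Phi\colon\mathbb{R}^+\times\mathbb{R}^+\to\mathbb{R}^+$ is a triangle function for $d$ if $\Phi$ is symmetric and non-decreasing in both of its arguments, $\Phi(0,0)=0$, and $d(x,y)\le\Phi(d(x,z),d(z,y))$ for all $x,y,z\in X$. A sequence $(x_n)$ in $X$ converges to $x\in X$ if $d(x_n,x)\to 0$; it is Cauchy if $d(x_n,x_m)\to 0$ as $n,m\to\infty$; $(X,d)$ is complete if every Cauchy sequence converges to some point of $X$. In condition (2) the expression is nested: for $p=1$ it is $\Phi(1,a)$, for $p=2$ it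 is $\Phi(1,\Phi(a,a^2))$, and so on. *)

theory Defs
  imports "HOL-Analysis.Analysis"
begin

text \<open>
  The half-line of nonnegative reals is rendered as the subset \<open>{0..}\<close> of \<^typ>\<open>real\<close>: functions into
  it are real-valued with a nonnegativity assumption, and functions on it are constrained only on
  nonnegative arguments.
\<close>

locale semimetric_space =
  fixes X :: "'a set" and d :: "'a \<Rightarrow> 'a \<Rightarrow> real"
  assumes nonempty: "X \<noteq> {}"
    and nonneg: "\<And>x y. x \<in> X \<Longrightarrow> y \<in> X \<Longrightarrow> 0 \<le> d x y"
    and zero_iff: "\<And>x y. x \<in> X \<Longrightarrow> y \<in> X \<Longrightarrow> d x y = 0 \<longleftrightarrow> x = y"
    and commute: "\<And>x y. x \<in> X \<Longrightarrow> y \<in> X \<Longrightarrow> d x y = d y x"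
begin

definition converges_to :: "(nat \<Rightarrow> 'a) \<Rightarrow> 'a \<Rightarrow> bool" where
  "converges_to s x \<longleftrightarrow> range s \<subseteq> X \<and> x \<in> X \<and> (\<lambda>n. d (s n) x) \<longlonglongrightarrow> 0"

definition cauchy :: "(nat \<Rightarrow> 'a) \<Rightarrow> bool" where
  "cauchy s \<longleftrightarrow> range s \<subseteq> X \<and> (\<forall>\<epsilon>>0. \<exists>N. \<forall>n\<ge>N. \<forall>m\<ge>N. d (s n) (s m) < \<epsilon>)"

definition complete :: bool where
  "complete \<longleftrightarrow> (\<forall>s. cauchy s \<longrightarrow> (\<exists>x. converges_to s x))"

definition triangle_function :: "(real \<Rightarrow> real \<Rightarrow> real) \<Rightarrow> bool" where
  "triangle_function \<Phi> \<longleftrightarrow>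
     (\<forall>u\<ge>0. \<forall>v\<ge>0. 0 \<le> \<Phi> u v) \<and>
     (\<forall>u\<ge>0. \<forall>v\<ge>0. \<Phi> u v = \<Phi> v u) \<and>
     (\<forall>u\<ge>0. \<forall>u'\<ge>u. \<forall>v\<ge>0. \<forall>v'\<ge>v. \<Phi> u v \<le> \<Phi> u' v') \<and>
     \<Phi> 0 0 = 0 \<and>
     (\<forall>x\<in>X. \<forall>y\<in>X. \<forall>z\<in>X. d x y \<le> \<Phi> (d x z) (d z y))"

end

text \<open>
  \<open>nested \<Phi> a p\<close> is \<open>\<Phi>(1, \<Phi>(a, \<Phi>(a\<^sup>2, \<dots>, \<Phi>(a\<^sup>p\<^sup>-\<^sup>1, a\<^sup>p))))\<close>; the leading \<open>1\<close> is \<open>a\<^sup>0\<close>, also for \<open>a = 0\<close>.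
\<close>
definition nested :: "(real \<Rightarrow> real \<Rightarrow> real) \<Rightarrow> real \<Rightarrow> nat \<Rightarrow> real" where
  "nested \<Phi> a p = foldr (\<lambda>i. \<Phi> (a ^ i)) [0..<p] (a ^ p)"

lemma nested_1: "nested \<Phi> a 1 = \<Phi> 1 a"
  by (simp add: nested_def)

lemma nested_2: "nested \<Phi> a 2 = \<Phi> 1 (\<Phi> a (a ^ 2))"
  by (simp add: nested_def numeral_2_eq_2)

end

theory Submission
  imports Defs
begin

text \<open>
  Write \<open>\<delta> x = d x (T x)\<close> for the displacement of \<open>x\<close>. Taking \<open>y = T x\<close> in the contractive condition
  shows that \<open>T\<close> shrinks displacements by the factor \<open>\<beta>\<close>, so along an orbit \<open>x\<^sub>n\<close> they tend to
  \<open>0\<close>. The contractive condition bounds the distance between two image points by displacements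
  alone: \<open>d x\<^bsub>n+1\<^esub> x\<^bsub>m+1\<^esub> \<le> \<beta> * max (\<delta> x\<^sub>n) (\<delta> x\<^sub>m)\<close>. Every orbit is therefore Cauchy.

  Let \<open>z\<close> be the limit of an orbit and \<open>D = d z (T z)\<close>. The triangle function and the contractive
  condition give \<open>D \<le> \<Phi> (d z x\<^bsub>n+1\<^esub>) (\<beta> * max (\<delta> x\<^sub>n) D)\<close>, which by continuity becomes
  \<open>D \<le> \<Phi> 0 (\<beta> * D)\<close> in the limit. By homogeneity the right-hand side is \<open>D * \<Phi> 0 \<beta>\<close>, and
  \<open>\<Phi> 0 \<beta> < 1\<close>, so \<open>D = 0\<close>. Fixed points have displacement \<open>0\<close>, so the contractive condition also
  leaves at most one of them.
\<close>

lemma (in semimetric_space) displacement_contracts: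
  fixes \<beta> :: real
  assumes T: "T \<in> X \<rightarrow> X" and \<beta>: "0 \<le> \<beta>" "\<beta> < 1"
    and contr: "\<And>x y. x \<in> X \<Longrightarrow> y \<in> X \<Longrightarrow> d (T x) (T y) \<le> \<beta> * max (d x (T x)) (d y (T y))"
    and x: "x \<in> X"
  shows "d (T x) (T (T x)) \<le> \<beta> * d x (T x)"
proof -
  have Tx: "T x \<in> X" "T (T x) \<in> X" using T x by auto
  have le: "d (T x) (T (T x)) \<le> \<beta> * max (d x (T x)) (d (T x) (T (T x)))"
    using contr[OF x Tx(1)] .
  show ?thesis
  proof (cases "d (T x) (T (T x)) \<le> d x (T x)")
    case True
    with le show ?thesis by (simp add: max_def split: if_splits)
  next
    \<comment> \<open>If the maximum were the new displacement \<open>e\<close>, then \<open>e \<le> \<beta> * e\<close> would force \<open>e = 0\<close>.\<close>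
    case False
    with le have "(1 - \<beta>) * d (T x) (T (T x)) \<le> 0"
      by (simp add: max_def algebra_simps)
    with \<beta> have "d (T x) (T (T x)) \<le> 0" by (simp add: mult_le_0_iff)
    with False nonneg[OF x Tx(1)] show ?thesis by linarith
  qed
qed

lemma (in semimetric_space) orbit_displacement_tendsto_0:
  fixes \<beta> :: real
  assumes T: "T \<in> X \<rightarrow> X" and \<beta>: "0 \<le> \<beta>" "\<beta> < 1"
    and contr: "\<And>x y. x \<in> X \<Longrightarrow> y \<in> X \<Longrightarrow> d (T x) (T y) \<le> \<beta> * max (d x (T x)) (d y (T y))"
    and x: "x \<in> X"
  shows "(\<lambda>n. d ((T ^^ n) x) (T ((T ^^ n) x))) \<longlonglongrightarrow> 0"
proof (rule tendsto_sandwich)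
  have orbit: "(T ^^ n) x \<in> X" for n
    using T x by (induction n) auto
  have "d ((T ^^ n) x) (T ((T ^^ n) x)) \<le> \<beta> ^ n * d x (T x)" for n
  proof (induction n)
    case (Suc n)
    have "d ((T ^^ Suc n) x) (T ((T ^^ Suc n) x)) \<le> \<beta> * d ((T ^^ n) x) (T ((T ^^ n) x))"
      using displacement_contracts[OF T \<beta> contr orbit[of n]] by simp
    also have "\<dots> \<le> \<beta> * (\<beta> ^ n * d x (T x))"
      using Suc \<beta> by (intro mult_left_mono)
    finally show ?case by simp
  qed simp
  then show "\<forall>\<^sub>F n in sequentially. d ((T ^^ n) x) (T ((T ^^ n) x)) \<le> \<beta> ^ n * d x (T x)"
    by simp
  show "\<forall>\<^sub>F n in sequentially. 0 \<le> d ((T ^^ n) x) (T ((T ^^ n) x))"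
    using orbit T by (auto intro!: always_eventually nonneg)
  show "(\<lambda>n. \<beta> ^ n * d x (T x)) \<longlonglongrightarrow> 0"
    using \<beta> by (intro tendsto_mult_left_zero LIMSEQ_realpow_zero)
qed simp

text \<open>
  The contractive condition bounds the distance of two orbit points by the displacements of their
  predecessors, so vanishing displacements give the Cauchy property directly. The orbit is taken
  from \<open>T x\<close> on, so that every term has a predecessor.
\<close>

lemma (in semimetric_space) orbit_cauchy:
  fixes \<beta> :: real
  assumes T: "T \<in> X \<rightarrow> X" and \<beta>: "0 \<le> \<beta>" "\<beta> < 1"
    and contr: "\<And>x y. x \<in> X \<Longrightarrow> y \<in> X \<Longrightarrow> d (T x) (T y) \<le> \<beta> * max (d x (T x)) (d y (T y))"
    and x: "x \<in> X"
  shows "cauchy (\<lambda>n. (T ^^ Suc n) x)"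
proof -
  have orbit: "(T ^^ n) x \<in> X" for n
    using T x by (induction n) auto
  have "\<exists>N. \<forall>n\<ge>N. \<forall>m\<ge>N. d ((T ^^ Suc n) x) ((T ^^ Suc m) x) < \<epsilon>" if "\<epsilon> > 0" for \<epsilon>
  proof -
    obtain N where N: "d ((T ^^ n) x) (T ((T ^^ n) x)) < \<epsilon>" if "n \<ge> N" for n
      using order_tendstoD(2)[OF orbit_displacement_tendsto_0[OF T \<beta> contr x] \<open>\<epsilon> > 0\<close>]
      by (auto simp: eventually_sequentially)
    have "d ((T ^^ Suc n) x) ((T ^^ Suc m) x) < \<epsilon>" if "n \<ge> N" "m \<ge> N" for n m
    proof -
      let ?M = "max (d ((T ^^ n) x) (T ((T ^^ n) x))) (d ((T ^^ m) x) (T ((T ^^ m) x)))"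
      have "0 \<le> ?M"
        using nonneg[OF orbit[of n] orbit[of "Suc n"]] by (simp add: le_max_iff_disj)
      then have "\<beta> * ?M \<le> ?M"
        using \<beta> by (simp add: mult_left_le_one_le)
      moreover have "?M < \<epsilon>" using N that by simp
      moreover have "d ((T ^^ Suc n) x) ((T ^^ Suc m) x) \<le> \<beta> * ?M"
        using contr[OF orbit[of n] orbit[of m]] by simp
      ultimately show ?thesis by linarith
    qed
    then show ?thesis by blast
  qed
  moreover have "range (\<lambda>n. (T ^^ Suc n) x) \<subseteq> X"
    using orbit by blast
  ultimately show ?thesis
    unfolding cauchy_def by blast
qed

text \<open>
  A positive displacement \<open>D\<close> of the limit would have to satisfy \<open>D \<le> \<Phi> 0 (\<beta> * D) = D * \<Phi> 0 \<beta> < D\<close>.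
\<close>

lemma (in semimetric_space) orbit_limit_is_fixed_point:
  fixes \<beta> :: real
  assumes \<Phi>: "triangle_function \<Phi>"
    and cont: "continuous_on ({0..} \<times> {0..}) (\<lambda>(u, v). \<Phi> u v)"
    and hom: "\<And>k u v. 0 \<le> k \<Longrightarrow> 0 \<le> u \<Longrightarrow> 0 \<le> v \<Longrightarrow> \<Phi> (k * u) (k * v) = k * \<Phi> u v"
    and \<Phi>0: "\<Phi> 0 \<beta> < 1"
    and T: "T \<in> X \<rightarrow> X" and \<beta>: "0 \<le> \<beta>" "\<beta> < 1"
    and contr: "\<And>x y. x \<in> X \<Longrightarrow> y \<in> X \<Longrightarrow> d (T x) (T y) \<le> \<beta> * max (d x (T x)) (d y (T y))"
    and x: "x \<in> X" and lim: "converges_to (\<lambda>n. (T ^^ Suc n) x) z"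
  shows "T z = z"
proof (rule ccontr)
  assume neq: "T z \<noteq> z"
  define D where "D = d z (T z)"
  let ?\<delta> = "\<lambda>n. d ((T ^^ n) x) (T ((T ^^ n) x))"
  let ?e = "\<lambda>n. d ((T ^^ Suc n) x) z"
  have orbit: "(T ^^ n) x \<in> X" for n
    using T x by (induction n) auto
  have z: "z \<in> X" and Tz: "T z \<in> X" and e: "?e \<longlonglongrightarrow> 0"
    using lim T by (auto simp: converges_to_def)
  have D: "D > 0"
    using nonneg[OF z Tz] zero_iff[OF z Tz] neq by (simp add: D_def)
  have e_nonneg: "0 \<le> ?e n" for n
    by (rule nonneg[OF orbit z])
  have bound: "D \<le> \<Phi> (?e n) (\<beta> * max (?\<delta> n) D)" for n
  proof -
    have "D \<le> \<Phi> (d z ((T ^^ Suc n) x)) (d ((T ^^ Suc n) x) (T z))"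
      using \<Phi> z Tz orbit[of "Suc n"] unfolding triangle_function_def D_def by blast
    also have "\<dots> = \<Phi> (?e n) (d ((T ^^ Suc n) x) (T z))"
      using commute[OF z orbit[of "Suc n"]] by simp
    also have "\<dots> \<le> \<Phi> (?e n) (\<beta> * max (?\<delta> n) D)"
    proof -
      have "0 \<le> d ((T ^^ Suc n) x) (T z)"
        by (rule nonneg[OF orbit Tz])
      moreover have "d ((T ^^ Suc n) x) (T z) \<le> \<beta> * max (?\<delta> n) D"
        using contr[OF orbit[of n] z] by (simp add: D_def)
      ultimately show ?thesis
        using \<Phi> e_nonneg[of n] unfolding triangle_function_def by blast
    qed
    finally show ?thesis .
  qed
  have "(\<lambda>n. \<beta> * max (?\<delta> n) D) \<longlonglongrightarrow> \<beta> * max 0 D"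
    using orbit_displacement_tendsto_0[OF T \<beta> contr x] by (intro tendsto_intros)
  then have "(\<lambda>n. (?e n, \<beta> * max (?\<delta> n) D)) \<longlonglongrightarrow> (0, \<beta> * D)"
    using e D by (auto intro: tendsto_Pair)
  moreover have "(?e n, \<beta> * max (?\<delta> n) D) \<in> {0..} \<times> {0..}" for n
    using e_nonneg[of n] \<beta> D by (simp add: le_max_iff_disj)
  ultimately have "(\<lambda>n. \<Phi> (?e n) (\<beta> * max (?\<delta> n) D)) \<longlonglongrightarrow> \<Phi> 0 (\<beta> * D)"
    using continuous_on_tendsto_compose[OF cont, of "\<lambda>n. (?e n, \<beta> * max (?\<delta> n) D)" "(0, \<beta> * D)" sequentially]
      \<beta> D by simp
  then have "D \<le> \<Phi> 0 (\<beta> * D)"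
    using bound by (intro LIMSEQ_le_const) auto
  also have "\<dots> = D * \<Phi> 0 \<beta>"
    using hom[of D 0 \<beta>] D \<beta> by (simp add: mult.commute)
  also have "\<dots> < D"
    using D \<Phi>0 by simp
  finally show False by simp
qed

theorem theorem2p4:
  fixes X :: "'a set" and d :: "'a \<Rightarrow> 'a \<Rightarrow> real"
    and \<Phi> :: "real \<Rightarrow> real \<Rightarrow> real"
    and T :: "'a \<Rightarrow> 'a" and \<beta> :: real
  assumes "semimetric_space X d"
    and "semimetric_space.complete X d"
    and "semimetric_space.triangle_function X d \<Phi>"
    and "continuous_on ({0..} \<times> {0..}) (\<lambda>(u, v). \<Phi> u v)"
    and "\<forall>k\<ge>0. \<forall>u\<ge>0. \<forall>v\<ge>0. \<Phi> (k * u) (k * v) = k * \<Phi> u v"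
    and "\<forall>a. 0 \<le> a \<and> a < 1 \<longrightarrow> (\<exists>C>0. \<forall>p\<ge>1. nested \<Phi> a p \<le> C)"
    and "\<forall>v. 0 \<le> v \<and> v < 1 \<longrightarrow> \<Phi> 0 v < 1"
    and "T \<in> X \<rightarrow> X"
    and "0 \<le> \<beta>" and "\<beta> < 1"
    and "\<forall>x\<in>X. \<forall>y\<in>X. d (T x) (T y) \<le> \<beta> * max (d x (T x)) (d y (T y))"
  shows "\<exists>!x. x \<in> X \<and> T x = x"
proof -
  interpret semimetric_space X d by fact
  have contr: "d (T x) (T y) \<le> \<beta> * max (d x (T x)) (d y (T y))" if "x \<in> X" "y \<in> X" for x y
    using assms(11) that by blast
  obtain x where x: "x \<in> X" using nonempty by blast
  obtain z where z: "converges_to (\<lambda>n. (T ^^ Suc n) x) z"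
    using orbit_cauchy[OF assms(8-10) contr x] assms(2) unfolding complete_def by blast
  have "T z = z"
  proof (rule orbit_limit_is_fixed_point[OF assms(3,4) _ _ assms(8-10) contr x z])
    show "\<Phi> (k * u) (k * v) = k * \<Phi> u v" if "0 \<le> k" "0 \<le> u" "0 \<le> v" for k u v
      using assms(5) that by blast
    show "\<Phi> 0 \<beta> < 1"
      using assms(7,9,10) by blast
  qed
  moreover have "z \<in> X"
    using z by (simp add: converges_to_def)
  moreover have "y = z" if "y \<in> X" "T y = y" for y
  proof -
    have "d y y = 0" "d z z = 0"
      using zero_iff that(1) \<open>z \<in> X\<close> by auto
    then have "d y z \<le> 0"
      using contr[OF that(1) \<open>z \<in> X\<close>] that(2) \<open>T z = z\<close> by simp
    then show ?thesis
      using nonneg[OF that(1) \<open>z \<in> X\<close>] zero_iff[OF that(1) \<open>z \<in> X\<close>] by simp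
  qed
  ultimately show ?thesis by blast
qed

end
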